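(* Let $n\ge 1$ and $L\ge n+1$ be integers and let $0\le q\le p\le 1$ with $p>0$. In the system with $L$ sites and $n$ ordinary particles, for all $2\le i\le L$, $$\langle\sigma_1\tau_i\rangle_{L,n}=\sum_{j=0}^{L-n-1}\sum_{k=0}^{j}\binom{L-i}{k}\binom{i-2}{j-k}p^kq^{j-k}\,\frac{\begin{Bmatrix}L-j-1\\ n\end{Bmatrix}_{p,q}}{Z_{L,n}(p,q)}.$$
   Context: Configurations: $\Omega_{L,n}$ is the set of words $\eta=(\eta_1,\dots,\eta_L)$ with letters in $\{0,1,\hat 1\}$ containing exactly one $\hat 1$ (tracer particle), exactly $n$ letters $1$ (ordinary particles) and $L-n-1$ letters $0$ (vacancies). Sites are indexed mod $L$. Dynamics: a continuous-time Markov chain on $\Omega_{L,n}$ in which, for each bond $(i,i+1)$ (mod $L$): $10\to 01$ at rate $1$, $01\to 10$ at rate $1$, $\hat 1 0\to 0\hat 1$ at rate $p$, $0\hat 1\to\hat 1 0$ at rate $q$; no other transitions occur. Steady state: for $L\ge n+2$, $\pi$ is the unique stationary distribution; for $L=n+1$ (no moves), $\pi$ is by convention uniform on $\Omega_{L,n}$. $\langle\cdot\rangle_{L,n}$ is expectation under $\pi$. $\sigma_i=1$ if $\eta_i=\hat 1$ and $0$ otherwise; $\tau_i=1$ if $\eta_i=1$ and $0$ otherwise. Partition functions: for $\eta\in\Omega_{L,n}$ with $\eta_1=\hat 1$, $$w(\eta)=\prod_{\substack{2\le i\le L\\ \eta_i=0}}\bigl(1+p\,m_i(\eta)+q\,n_i(\eta)\bigr),$$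 where $m_i(\eta)$ (resp. $n_i(\eta)$) is the number of $1$'s among $\eta_2,\dots,\eta_{i-1}$ (resp. $\eta_{i+1},\dots,\eta_L$). Put $$\begin{Bmatrix}L\\ n+1\end{Bmatrix}_{p,q}=\sum_{\eta\in\Omega_{L,n},\ \eta_1=\hat 1}w(\eta)\quad(0\le n\le L-1),\qquad Z_{L,n}(p,q)=L\begin{Bmatrix}L\\ n+1\end{Bmatrix}_{p,q}.$$ *)

theory Defs
  imports "HOL-Probability.Probability"
begin

datatype letter = Vacancy | Particle | Tracer

(* Sites are numbered 1, ..., L, whereas list positions start at 0. *)
definition site :: "letter list \<Rightarrow> nat \<Rightarrow> letter" where
  "site \<eta> i = \<eta> ! (i - 1)"

(* The remaining L - n - 1 letters are vacancies. *)
definition configs :: "nat \<Rightarrow> nat \<Rightarrow> letter list set" where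
  "configs L n = {\<eta>. length \<eta> = L \<and> count_list \<eta> Tracer = 1 \<and> count_list \<eta> Particle = n}"

definition next_site :: "nat \<Rightarrow> nat \<Rightarrow> nat" where
  "next_site L i = (if i = L then 1 else i + 1)"

definition swap_bond :: "nat \<Rightarrow> letter list \<Rightarrow> letter list" where
  "swap_bond i \<eta> =
     (let i' = next_site (length \<eta>) i
      in \<eta>[i - 1 := site \<eta> i', i' - 1 := site \<eta> i])"

fun swap_rate :: "real \<Rightarrow> real \<Rightarrow> letter \<Rightarrow> letter \<Rightarrow> real" where
  "swap_rate p q Particle Vacancy = 1"
| "swap_rate p q Vacancy Particle = 1"
| "swap_rate p q Tracer Vacancy = p"
| "swap_rate p q Vacancy Tracer = q"
| "swap_rate p q _ _ = 0"

definition rate :: "real \<Rightarrow> real \<Rightarrow> letter list \<Rightarrow> letter list \<Rightarrow> real" where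
  "rate p q \<eta> \<xi> =
     (\<Sum>i = 1..length \<eta>.
        if \<xi> = swap_bond i \<eta>
        then swap_rate p q (site \<eta> i) (site \<eta> (next_site (length \<eta>) i)) else 0)"

(* Global balance: total probability flow into each configuration equals the flow out of it. *)
definition stationary :: "real \<Rightarrow> real \<Rightarrow> nat \<Rightarrow> nat \<Rightarrow> letter list pmf \<Rightarrow> bool" where
  "stationary p q L n \<pi> \<longleftrightarrow>
     set_pmf \<pi> \<subseteq> configs L n \<and>
     (\<forall>\<eta>\<in>configs L n.
        (\<Sum>\<xi>\<in>configs L n. pmf \<pi> \<xi> * rate p q \<xi> \<eta>) =
        pmf \<pi> \<eta> * (\<Sum>\<xi>\<in>configs L n. rate p q \<eta> \<xi>))"

(* For L = n + 1 there are no vacancies, hence no moves, and every distribution is stationary;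
   the uniform one is chosen by convention. *)
definition steady_state :: "real \<Rightarrow> real \<Rightarrow> nat \<Rightarrow> nat \<Rightarrow> letter list pmf" where
  "steady_state p q L n =
     (if L = n + 1 then pmf_of_set (configs L n) else (THE \<pi>. stationary p q L n \<pi>))"

definition \<sigma> :: "nat \<Rightarrow> letter list \<Rightarrow> real" where
  "\<sigma> i \<eta> = of_bool (site \<eta> i = Tracer)"

definition \<tau> :: "nat \<Rightarrow> letter list \<Rightarrow> real" where
  "\<tau> i \<eta> = of_bool (site \<eta> i = Particle)"

definition particles_before :: "letter list \<Rightarrow> nat \<Rightarrow> nat" where
  "particles_before \<eta> i = card {j \<in> {2..<i}. site \<eta> j = Particle}"

definition particles_after :: "letter list \<Rightarrow> nat \<Rightarrow> nat" where
  "particles_after \<eta> i = card {j \<in> {i<..length \<eta>}. site \<eta> j = Particle}"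

definition weight :: "real \<Rightarrow> real \<Rightarrow> letter list \<Rightarrow> real" where
  "weight p q \<eta> =
     (\<Prod>i | i \<in> {2..length \<eta>} \<and> site \<eta> i = Vacancy.
        1 + p * real (particles_before \<eta> i) + q * real (particles_after \<eta> i))"

(* brace p q L m is the symbol with upper entry L and lower entry m = n + 1, where n is the
   number of ordinary particles; it is meaningful only for 1 \<le> m \<le> L. *)
definition brace :: "real \<Rightarrow> real \<Rightarrow> nat \<Rightarrow> nat \<Rightarrow> real" where
  "brace p q L m = (\<Sum>\<eta> | \<eta> \<in> configs L (m - 1) \<and> site \<eta> 1 = Tracer. weight p q \<eta>)"

definition Z :: "real \<Rightarrow> real \<Rightarrow> nat \<Rightarrow> nat \<Rightarrow> real" where
  "Z p q L n = real L * brace p q L (n + 1)"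

end

(* Seen from the tracer, a configuration is a word of particles and vacancies, and the steady state
   is proportional to the weight w. Exchanging a particle with a neighbouring vacancy changes one
   factor A of w by p - q, so the net flow through the particle bonds is (p - q) w times the
   alternating sum of the numbers 1 / A over the ends of the runs of vacancies. Only the two ends next
   to the tracer survive, and they are compensated by the moves of the tracer. The stationary measure
   is unique by the maximum principle for the ratio of two stationary measures.

   If site i is occupied, removing that particle turns the factors of the vacancies on its left and
   right into A + q and A + p. Summing over words site by site is the iteration of a transfer operator
   T, so the correlation is (T + q)^(i - 2) (T + p)^(L - i), and the double sum is its binomial
   expansion. *)
theory Submission
  imports Defs
begin

section \<open>Weights of words\<close>

definition words :: "nat \<Rightarrow> nat \<Rightarrow> letter list set" where
  "words N n = {v. length v = N \<and> Tracer \<notin> set v \<and> count_list v Particle = n}"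

text \<open>The parameter \<open>A\<close> is the factor \<open>1 + p m + q n\<close> carried by a vacancy at the current place;
  passing a particle changes it by \<open>d = p - q\<close>.\<close>
fun word_weight :: "real \<Rightarrow> real \<Rightarrow> letter list \<Rightarrow> real" where
  "word_weight d A [] = 1"
| "word_weight d A (x # v) =
     (if x = Vacancy then A * word_weight d A v else word_weight d (A + d) v)"

lemma word_weight_pos:
  assumes "0 < A" "0 \<le> d"
  shows "0 < word_weight d A v"
  using assms by (induction v arbitrary: A) auto

text \<open>By the time the last vacancy is read, each particle of \<open>v\<close> has raised the
  parameter by \<open>d\<close>. This gives the new factor of a vacancy that a tracer move carries
  from one end of the word to the other.\<close>

lemma word_weight_snoc_Vacancy:
  assumes "Tracer \<notin> set v"
  shows "word_weight d A (v @ [Vacancy]) = (A + d * real (count_list v Particle)) * word_weight d A v"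
  using assms
proof (induction v arbitrary: A)
  case (Cons x v)
  then show ?case by (cases x) (auto simp: algebra_simps)
qed auto

lemma word_weight_no_Vacancy: "Vacancy \<notin> set v \<Longrightarrow> word_weight d A v = 1"
  by (induction v arbitrary: A) auto

text \<open>The numbers of particles left and right of a vacancy add up to the total, so its factor
  depends on the left number only, with slope \<open>p - q\<close>. The constant \<open>A\<close> is
  general because a leading particle turns it into \<open>A + p\<close> in the induction.\<close>

lemma prod_Vacancy_eq_word_weight:
  assumes "Tracer \<notin> set v"
  shows "(\<Prod>k<length v. if v ! k = Vacancy
            then A + p * real (count_list (take k v) Particle)
                   + q * real (count_list (drop (Suc k) v) Particle) else 1)
         = word_weight (p - q) (A + q * real (count_list v Particle)) v"
  using assms
proof (induction v arbitrary: A)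
  case (Cons x v)
  show ?case
  proof (cases x)
    case Particle
    have "(\<Prod>k<length v. if v ! k = Vacancy
            then A + p * real (Suc (count_list (take k v) Particle))
                   + q * real (count_list (drop (Suc k) v) Particle) else 1)
       = (\<Prod>k<length v. if v ! k = Vacancy
            then (A + p) + p * real (count_list (take k v) Particle)
                   + q * real (count_list (drop (Suc k) v) Particle) else 1)"
      by (intro prod.cong) (auto simp: algebra_simps)
    also have "\<dots> = word_weight (p - q) (A + p + q * real (count_list v Particle)) v"
      using Cons by auto
    finally show ?thesis
      using Particle
      by (simp add: prod.lessThan_Suc_shift algebra_simps del: prod.lessThan_Suc cong: if_cong)
  qed (use Cons in \<open>auto simp: prod.lessThan_Suc_shift simp del: prod.lessThan_Suc cong: if_cong\<close>)
qed auto

section \<open>Matching the site-indexed weight with the recursive one\<close>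

lemma count_list_eq_card: "count_list xs a = card {k. k < length xs \<and> xs ! k = a}"
  by (simp add: count_list_eq_length_filter length_filter_conv_card eq_commute)

text \<open>Site \<open>k + 2\<close> holds \<open>v ! k\<close>: one shift because sites start at
  1, one for the leading letter.\<close>

lemma particles_before_Cons:
  assumes "k \<le> length v"
  shows "particles_before (x # v) (k + 2) = count_list (take k v) Particle"
proof -
  have "{j \<in> {2..<k + 2}. site (x # v) j = Particle}
      = (\<lambda>j. j + 2) ` {j. j < length (take k v) \<and> take k v ! j = Particle}" (is "?A = ?B")
  proof
    show "?A \<subseteq> ?B"
    proof
      fix j assume j: "j \<in> ?A"
      then have "j = (j - 2) + 2" "j - 2 < k" by auto
      moreover have "v ! (j - 2) = Particle"
        using j by (cases "j - 1") (auto simp: site_def numeral_2_eq_2)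
      ultimately show "j \<in> ?B" using assms by force
    qed
  qed (use assms in \<open>auto simp: site_def\<close>)
  then show ?thesis
    unfolding particles_before_def count_list_eq_card by (simp add: card_image inj_on_def)
qed

lemma particles_after_Cons:
  assumes "k < length v"
  shows "particles_after (x # v) (k + 2) = count_list (drop (Suc k) v) Particle"
proof -
  have "{j \<in> {k + 2<..length (x # v)}. site (x # v) j = Particle}
      = (\<lambda>j. j + (k + 3)) ` {j. j < length (drop (Suc k) v) \<and> drop (Suc k) v ! j = Particle}"
    (is "?A = ?B")
  proof
    show "?A \<subseteq> ?B"
    proof
      fix j assume j: "j \<in> ?A"
      then obtain l where l: "j = l + (k + 3)"
        using le_Suc_ex[of "k + 3" j] by (auto simp: add.commute)
      then show "j \<in> ?B" using j by (auto simp: site_def add.commute)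
    qed
  qed (use assms in \<open>auto simp: site_def add.commute\<close>)
  then show ?thesis
    unfolding particles_after_def count_list_eq_card by (simp add: card_image)
qed

lemma weight_Cons_Tracer:
  assumes "Tracer \<notin> set v"
  shows "weight p q (Tracer # v)
       = word_weight (p - q) (1 + q * real (count_list v Particle)) v"
proof -
  let ?g = "\<lambda>i. 1 + p * real (particles_before (Tracer # v) i)
                  + q * real (particles_after (Tracer # v) i)"
  have "weight p q (Tracer # v)
      = (\<Prod>i\<in>{2..length (Tracer # v)}. if site (Tracer # v) i = Vacancy then ?g i else 1)"
    unfolding weight_def by (subst prod.inter_filter[symmetric]) simp_all
  also have "\<dots> = (\<Prod>k<length v. if site (Tracer # v) (k + 2) = Vacancy then ?g (k + 2) else 1)"
    by (rule prod.reindex_bij_witness[where i = "\<lambda>k. k + 2" and j = "\<lambda>i. i - 2"])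
       (auto simp del: add_2_eq_Suc')
  also have "\<dots> = (\<Prod>k<length v. if v ! k = Vacancy
            then 1 + p * real (count_list (take k v) Particle)
                   + q * real (count_list (drop (Suc k) v) Particle) else 1)"
    by (intro prod.cong refl)
       (simp add: particles_before_Cons particles_after_Cons site_def del: add_2_eq_Suc')
  finally show ?thesis using prod_Vacancy_eq_word_weight[OF assms] by simp
qed

section \<open>Finiteness, and the partition function as a sum over words\<close>

lemma finite_letters: "finite (UNIV :: letter set)"
proof -
  have "UNIV = {Vacancy, Particle, Tracer}" using letter.exhaust by auto
  then show ?thesis by (metis finite.emptyI finite.insertI)
qed

lemma finite_lists_length: "finite {v :: letter list. length v = N}"
  using finite_lists_length_eq[OF finite_letters] by simp

lemma finite_words [simp]: "finite (words N n)"
  by (rule finite_subset[OF _ finite_lists_length[of N]]) (auto simp: words_def)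

lemma finite_configs [simp]: "finite (configs L n)"
  by (rule finite_subset[OF _ finite_lists_length[of L]]) (auto simp: configs_def)

lemma configs_Tracer_first:
  "{\<eta> \<in> configs (Suc N) n. site \<eta> 1 = Tracer} = Cons Tracer ` words N n"
proof
  show "{\<eta> \<in> configs (Suc N) n. site \<eta> 1 = Tracer} \<subseteq> Cons Tracer ` words N n"
  proof
    fix \<eta> assume "\<eta> \<in> {\<eta> \<in> configs (Suc N) n. site \<eta> 1 = Tracer}"
    then show "\<eta> \<in> Cons Tracer ` words N n"
      by (cases \<eta>) (auto simp: configs_def words_def site_def count_list_0_iff)
  qed
qed (auto simp: configs_def words_def site_def count_list_0_iff)

lemma brace_eq_sum_words:
  "brace p q (Suc N) (Suc n) = (\<Sum>v\<in>words N n. word_weight (p - q) (1 + q * real n) v)"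
proof -
  have "brace p q (Suc N) (Suc n) = (\<Sum>v\<in>words N n. weight p q (Tracer # v))"
    unfolding brace_def diff_Suc_1 configs_Tracer_first by (simp add: sum.reindex)
  also have "\<dots> = (\<Sum>v\<in>words N n. word_weight (p - q) (1 + q * real n) v)"
    by (intro sum.cong refl) (auto simp: weight_Cons_Tracer words_def)
  finally show ?thesis .
qed

section \<open>Transfer operators\<close>

text \<open>The effect of prepending a letter: a vacancy gives the factor \<open>A + c\<close>, a
  particle shifts the parameter and uses up one of the \<open>n\<close> particles. Since
  \<open>c\<close> is kept apart from \<open>A\<close>, operators with different offsets differ by a
  multiple of the identity.\<close>

definition transfer ::
    "real \<Rightarrow> real \<Rightarrow> (real \<Rightarrow> nat \<Rightarrow> real) \<Rightarrow> real \<Rightarrow> nat \<Rightarrow> real" where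
  "transfer d c f A n = (A + c) * f A n + (case n of 0 \<Rightarrow> 0 | Suc m \<Rightarrow> f (A + d) m)"

text \<open>The start of the iteration: the weight sum over words of length 0.\<close>

definition no_particles :: "real \<Rightarrow> nat \<Rightarrow> real" where
  "no_particles A n = of_bool (n = 0)"

lemma words_Suc:
  "words (Suc N) n = Cons Vacancy ` words N n \<union>
     (case n of 0 \<Rightarrow> {} | Suc m \<Rightarrow> Cons Particle ` words N m)" (is "_ = ?R")
proof
  show "words (Suc N) n \<subseteq> ?R"
  proof
    fix v assume v: "v \<in> words (Suc N) n"
    then obtain x u where xu: "v = x # u" by (cases v) (auto simp: words_def)
    then show "v \<in> ?R" using v by (cases x) (auto simp: words_def image_iff)
  qed
qed (auto simp: words_def split: nat.splits)

lemma sum_words_Suc: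
  fixes f :: "letter list \<Rightarrow> real"
  shows "(\<Sum>v\<in>words (Suc N) n. f v) = (\<Sum>v\<in>words N n. f (Vacancy # v))
     + (case n of 0 \<Rightarrow> 0 | Suc m \<Rightarrow> \<Sum>v\<in>words N m. f (Particle # v))"
proof (cases n)
  case 0
  then show ?thesis by (simp add: words_Suc sum.reindex)
next
  case (Suc m)
  have "(\<Sum>v\<in>words (Suc N) n. f v)
      = sum f (Cons Vacancy ` words N n) + sum f (Cons Particle ` words N m)"
    unfolding words_Suc Suc by (simp, subst sum.union_disjoint) auto
  then show ?thesis using Suc by (simp add: sum.reindex)
qed

lemma sum_word_weight:
  "(\<Sum>v\<in>words N n. word_weight d (A + c) v) = (transfer d c ^^ N) no_particles A n"
proof (induction N arbitrary: A n)
  case 0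
  have "words 0 n = (if n = 0 then {[]} else {})" by (auto simp: words_def)
  then show ?case by (auto simp: no_particles_def)
next
  case (Suc N)
  have "(\<Sum>v\<in>words N m. word_weight d (A + c + d) v) = (transfer d c ^^ N) no_particles (A + d) m" for m
    using Suc.IH[of "A + d" m] by (simp add: add_ac)
  then show ?case
    by (simp add: sum_words_Suc transfer_def[of d c "(transfer d c ^^ N) no_particles"]
        Suc.IH sum_distrib_left[symmetric] split: nat.split)
qed

text \<open>Deleting the particle at position \<open>a\<close> leaves a word in which the vacancies on its left carry
  an additional \<open>q\<close>, and those on its right an additional \<open>q + d = p\<close>.\<close>
lemma sum_word_weight_Particle_at:
  "(\<Sum>v\<in>words (Suc (a + b)) (Suc n). of_bool (v ! a = Particle) * word_weight d (A + q) v)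
     = (transfer d q ^^ a) ((transfer d (q + d) ^^ b) no_particles) A n"
proof (induction a arbitrary: A n)
  case 0
  have "(\<Sum>v\<in>words b n. word_weight d (A + q + d) v) = (transfer d (q + d) ^^ b) no_particles A n"
    using sum_word_weight[where A = A and c = "q + d"] by (simp add: add_ac)
  then show ?case by (simp add: sum_words_Suc)
next
  case (Suc a)
  \<comment> \<open>If the leading letter is the only particle, the marked position cannot hold one;
    this matches the 0 in \<open>transfer\<close> at \<open>n = 0\<close>.\<close>
  have 0: "of_bool (v ! a = Particle) * word_weight d (A + q + d) v = 0"
    if "v \<in> words (Suc (a + b)) 0" for v
    using that by (auto simp: words_def count_list_0_iff) (metis less_Suc_eq_le le_add1 nth_mem)
  have "(\<Sum>v\<in>words (Suc (a + b)) (Suc m). of_bool (v ! a = Particle) * word_weight d (A + q + d) v)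
      = (transfer d q ^^ a) ((transfer d (q + d) ^^ b) no_particles) (A + d) m" for m
    using Suc.IH[of "A + d" m] by (simp add: add_ac)
  moreover have "(\<Sum>v\<in>words (Suc (a + b)) (Suc n).
        of_bool (v ! a = Particle) * ((A + q) * word_weight d (A + q) v))
      = (A + q) * (transfer d q ^^ a) ((transfer d (q + d) ^^ b) no_particles) A n"
    unfolding Suc.IH[symmetric] sum_distrib_left by (intro sum.cong) auto
  ultimately show ?case
    using 0 by (simp add: sum_words_Suc[where N = "Suc (a + b)"]
        transfer_def[of d q "(transfer d q ^^ a) ((transfer d (q + d) ^^ b) no_particles)" A n]
        split: nat.split)
qed

section \<open>Linearity and binomial expansion of the transfer operator\<close>

lemma transfer_sum:
  "transfer d c (\<lambda>A n. \<Sum>j\<in>S. g j * F j A n) = (\<lambda>A n. \<Sum>j\<in>S. g j * transfer d c (F j) A n)"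
  by (rule ext)+
     (auto simp: transfer_def sum_distrib_left sum.distrib[symmetric] algebra_simps
           split: nat.split)

lemma transfer_funpow_sum:
  "(transfer d c ^^ m) (\<lambda>A n. \<Sum>j\<in>S. g j * F j A n)
     = (\<lambda>A n. \<Sum>j\<in>S. g j * (transfer d c ^^ m) (F j) A n)"
  by (induction m) (simp_all add: transfer_sum)

text \<open>Pascal's rule in summed form.\<close>

lemma sum_choose_Suc:
  fixes x :: "nat \<Rightarrow> real"
  shows "(\<Sum>j\<le>Suc a. real (Suc a choose j) * x j)
       = (\<Sum>j\<le>a. real (a choose j) * (x j + x (Suc j)))"
proof -
  have "(\<Sum>j\<le>Suc a. real (Suc a choose j) * x j)
      = x 0 + (\<Sum>j\<le>a. real (a choose Suc j) * x (Suc j)) + (\<Sum>j\<le>a. real (a choose j) * x (Suc j))"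
    by (simp add: sum.atMost_Suc_shift sum.distrib algebra_simps del: sum.atMost_Suc)
  also have "x 0 + (\<Sum>j\<le>a. real (a choose Suc j) * x (Suc j)) = (\<Sum>j\<le>Suc a. real (a choose j) * x j)"
    by (simp add: sum.atMost_Suc_shift del: sum.atMost_Suc)
  also have "\<dots> = (\<Sum>j\<le>a. real (a choose j) * x j)" by simp
  finally show ?thesis by (simp add: sum.distrib algebra_simps)
qed

text \<open>\<open>transfer d c\<close> is \<open>transfer d 0\<close> plus \<open>c\<close> times
  the identity, and these commute, so the binomial theorem holds for its powers.\<close>

lemma transfer_binomial:
  "(transfer d c ^^ a) f
     = (\<lambda>A n. \<Sum>j\<le>a. (real (a choose j) * c ^ j) * (transfer d 0 ^^ (a - j)) f A n)"
proof (induction a)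
  case (Suc a)
  have split: "transfer d c g A n = transfer d 0 g A n + c * g A n" for g A n
    by (simp add: transfer_def algebra_simps)
  have "(transfer d c ^^ Suc a) f A n
      = (\<Sum>j\<le>Suc a. real (Suc a choose j) * (c ^ j * (transfer d 0 ^^ (Suc a - j)) f A n))" for A n
  proof -
    have "(transfer d c ^^ Suc a) f A n
        = (\<Sum>j\<le>a. real (a choose j) * c ^ j * transfer d c ((transfer d 0 ^^ (a - j)) f) A n)"
      by (simp add: Suc.IH transfer_sum)
    also have "\<dots> = (\<Sum>j\<le>a. real (a choose j) * (c ^ j * (transfer d 0 ^^ (Suc a - j)) f A n
                              + c ^ Suc j * (transfer d 0 ^^ (Suc a - Suc j)) f A n))"
      by (intro sum.cong refl, subst split) (simp add: Suc_diff_le algebra_simps)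
    also have "\<dots> = (\<Sum>j\<le>Suc a. real (Suc a choose j) * (c ^ j * (transfer d 0 ^^ (Suc a - j)) f A n))"
      by (rule sum_choose_Suc[symmetric])
    finally show ?thesis .
  qed
  then show ?case by (intro ext) (simp only: mult.assoc)
qed simp

lemma words_empty: "N < n \<Longrightarrow> words N n = {}"
  using count_le_length[of _ Particle] by (auto simp: words_def not_le[symmetric])

text \<open>After both expansions the powers of \<open>transfer (p - q) 0\<close> merge into one,
  which is a partition function. The indices \<open>k\<close> and \<open>j - k\<close> count the
  vacancies traded for a factor \<open>p\<close> on the right and \<open>q\<close> on the left of
  the marked particle.\<close>

lemma sum_Particle_at:
  "(\<Sum>v\<in>words (Suc (a + b)) (Suc n).
       of_bool (v ! a = Particle) * word_weight (p - q) (1 + q * real (Suc n)) v)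
   = (\<Sum>j\<le>a + b - n. \<Sum>k\<le>j.
       real (b choose k) * real (a choose (j - k)) * p ^ k * q ^ (j - k)
         * brace p q (Suc (a + b - j)) (Suc n))" if "n \<le> a + b"
proof -
  \<comment> \<open>The base parameter for the \<open>n\<close> particles left after the deletion;
    \<open>1 + q * real (Suc n)\<close> is \<open>A + q\<close>.\<close>
  define A where "A = 1 + q * real n"
  define U where "U m = (\<Sum>v\<in>words m n. word_weight (p - q) A v)" for m
  define g where
    "g k i = real (b choose k) * real (a choose i) * p ^ k * q ^ i * U (a + b - (k + i))" for k i
  have U: "(transfer (p - q) 0 ^^ m) no_particles A n = U m" for m
    using sum_word_weight[where c = 0] by (simp add: U_def)
  have add: "(transfer (p - q) 0 ^^ l) ((transfer (p - q) 0 ^^ m) f) = (transfer (p - q) 0 ^^ (l + m)) f"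
    for l m f by (simp add: funpow_add)
  have "(\<Sum>v\<in>words (Suc (a + b)) (Suc n).
       of_bool (v ! a = Particle) * word_weight (p - q) (1 + q * real (Suc n)) v)
     = (transfer (p - q) q ^^ a) ((transfer (p - q) p ^^ b) no_particles) A n"
    using sum_word_weight_Particle_at[where a = a and b = b and n = n and d = "p - q"
      and A = A and q = q]
    by (simp add: A_def algebra_simps)
  also have "\<dots> = (\<Sum>k\<le>b. \<Sum>i\<le>a. real (b choose k) * p ^ k * (real (a choose i) * q ^ i
        * U (a - i + (b - k))))"
    unfolding transfer_binomial[where c = q] transfer_binomial[where c = p]
      transfer_funpow_sum sum_distrib_left
    by (simp add: add U)
  also have "\<dots> = (\<Sum>k\<le>b. \<Sum>i\<le>a. g k i)"
    by (intro sum.cong refl) (simp add: g_def add.commute)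
  also have "\<dots> = (\<Sum>(k, i)\<in>{..b} \<times> {..a}. g k i)"
    by (rule sum.cartesian_product)
  \<comment> \<open>Outside the rectangle a binomial coefficient vanishes; beyond the triangle fewer
    than \<open>n\<close> letters remain for \<open>n\<close> particles.\<close>
  also have "\<dots> = (\<Sum>(k, i)\<in>{(k, i). k + i \<le> a + b - n}. g k i)"
  proof (rule sum.mono_neutral_cong)
    show "finite {(k, i). k + i \<le> a + b - n}"
      by (rule finite_subset[of _ "{..a + b} \<times> {..a + b}"]) auto
    fix x assume x: "x \<in> {..b} \<times> {..a} - {(k, i). k + i \<le> a + b - n}"
    then obtain k i where ki: "x = (k, i)" "k \<le> b" "i \<le> a" "k + i > a + b - n" by auto
    then have "a + b - (k + i) < n" using that by linarith
    then show "(case x of (k, i) \<Rightarrow> g k i) = 0" using ki by (simp add: g_def U_def words_empty)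
  qed (auto simp: g_def)
  also have "\<dots> = (\<Sum>j\<le>a + b - n. \<Sum>k\<le>j. g k (j - k))"
    by (rule sum.triangle_reindex_eq)
  also have "\<dots> = (\<Sum>j\<le>a + b - n. \<Sum>k\<le>j.
       real (b choose k) * real (a choose (j - k)) * p ^ k * q ^ (j - k)
         * brace p q (Suc (a + b - j)) (Suc n))"
    by (intro sum.cong refl) (simp add: g_def brace_eq_sum_words U_def A_def)
  finally show ?thesis .
qed

section \<open>The product measure is stationary\<close>

text \<open>The word read cyclically from the site after the tracer; it forgets where the tracer
  stands.\<close>

definition environment :: "letter list \<Rightarrow> letter list" where
  "environment \<eta> = tl (dropWhile (\<lambda>x. x \<noteq> Tracer) \<eta>) @ takeWhile (\<lambda>x. x \<noteq> Tracer) \<eta>"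

text \<open>Extends \<open>weight\<close> from configurations with the tracer at site 1 to all of
  \<open>configs L n\<close>, invariantly under rotation.\<close>

definition ring_weight :: "real \<Rightarrow> real \<Rightarrow> nat \<Rightarrow> letter list \<Rightarrow> real" where
  "ring_weight p q n \<eta> = word_weight (p - q) (1 + q * real n) (environment \<eta>)"

text \<open>The net unnormalized flow into \<open>\<eta>\<close> through bond \<open>i\<close>. An
  exchange undoes itself, so the only candidate for a predecessor through this bond is
  \<open>swap_bond i \<eta>\<close>, which carries the two letters in the opposite order.\<close>

definition imbalance :: "real \<Rightarrow> real \<Rightarrow> nat \<Rightarrow> letter list \<Rightarrow> nat \<Rightarrow> real" where
  "imbalance p q n \<eta> i =
     ring_weight p q n (swap_bond i \<eta>)
       * swap_rate p q (site \<eta> (next_site (length \<eta>) i)) (site \<eta> i)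
     - ring_weight p q n \<eta> * swap_rate p q (site \<eta> i) (site \<eta> (next_site (length \<eta>) i))"

lemma environment_append: "Tracer \<notin> set u \<Longrightarrow> environment (u @ Tracer # v) = v @ u"
  unfolding environment_def by (subst dropWhile_append2, blast, subst takeWhile_append2, blast) auto

lemma environment_Tracer_first: "environment (Tracer # v) = v"
  using environment_append[of "[]"] by simp

lemma configs_split:
  assumes "\<eta> \<in> configs L n"
  obtains u v where "\<eta> = u @ Tracer # v" "v @ u \<in> words (L - 1) n"
proof -
  have "Tracer \<in> set \<eta>" using assms by (auto simp: configs_def intro: ccontr)
  then obtain u v where uv: "\<eta> = u @ Tracer # v" by (meson split_list)
  then have "v @ u \<in> words (L - 1) n"
    using assms by (auto simp: configs_def words_def count_list_0_iff)
  with uv show ?thesis using that by blast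
qed

lemma configs_length: "\<eta> \<in> configs L n \<Longrightarrow> length \<eta> = L"
  by (simp add: configs_def)

lemma configs_mset: "mset \<eta> = mset \<xi> \<Longrightarrow> \<eta> \<in> configs L n \<longleftrightarrow> \<xi> \<in> configs L n"
  unfolding configs_def by (auto simp: count_mset[symmetric] dest: mset_eq_length)

section \<open>Exchanges across a bond and the balance with the tracer at site 1\<close>

lemma swap_bond_props:
  assumes "1 \<le> i" "i \<le> length \<eta>"
  shows length_swap_bond: "length (swap_bond i \<eta>) = length \<eta>"
    and mset_swap_bond: "mset (swap_bond i \<eta>) = mset \<eta>"
    and site_swap_bond: "site (swap_bond i \<eta>) i = site \<eta> (next_site (length \<eta>) i)"
    and site_next_swap_bond: "site (swap_bond i \<eta>) (next_site (length \<eta>) i) = site \<eta> i"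
    and swap_bond_swap_bond: "swap_bond i (swap_bond i \<eta>) = \<eta>"
proof -
  let ?j = "next_site (length \<eta>) i - 1"
  have j: "?j < length \<eta>" and i: "i - 1 < length \<eta>"
    using assms by (auto simp: next_site_def)
  have eq: "swap_bond i \<eta> = \<eta>[i - 1 := \<eta> ! ?j, ?j := \<eta> ! (i - 1)]"
    by (simp add: swap_bond_def Let_def site_def)
  show l: "length (swap_bond i \<eta>) = length \<eta>" by (simp add: eq)
  show "mset (swap_bond i \<eta>) = mset \<eta>"
    unfolding eq by (rule mset_swap[OF j i])
  show s1: "site (swap_bond i \<eta>) i = site \<eta> (next_site (length \<eta>) i)"
    using i j by (simp add: eq site_def nth_list_update)
  show s2: "site (swap_bond i \<eta>) (next_site (length \<eta>) i) = site \<eta> i"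
    using i j by (simp add: eq site_def nth_list_update)
  show "swap_bond i (swap_bond i \<eta>) = \<eta>"
    by (subst swap_bond_def) (simp add: Let_def l s1 s2,
        rule nth_equalityI, use i j in \<open>auto simp: eq site_def nth_list_update\<close>)
qed

lemma swap_bond_in_configs:
  assumes "\<eta> \<in> configs L n" "1 \<le> i" "i \<le> L"
  shows "swap_bond i \<eta> \<in> configs L n"
  using assms configs_mset mset_swap_bond configs_length by metis

text \<open>All vacancies of a run share one factor \<open>B\<close>. Exchanging its right end with
  a particle changes the weight by the fraction \<open>d / B\<close>, exchanging its left end by
  \<open>- d / B\<close>, so a run between two particles contributes nothing. What is left is the
  right end of a run at the beginning and the left end of a run at the end of the word.\<close>

lemma interior_swaps:
  assumes "Tracer \<notin> set v" "v \<noteq> []" "0 < A" "0 \<le> d"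
  shows "(\<Sum>i<length v - 1. if v ! i = v ! Suc i then 0
            else word_weight d A (v[i := v ! Suc i, Suc i := v ! i]) - word_weight d A v)
       = word_weight d A v * d * (of_bool (hd v = Vacancy) / A
           - of_bool (last v = Vacancy) / (A + d * real (count_list v Particle)))"
  using assms
proof (induction v arbitrary: A)
  case (Cons x v)
  show ?case
  proof (cases v)
    case Nil
    then show ?thesis by simp
  next
    case (Cons y w)
    let ?D = "\<lambda>A v i. if v ! i = v ! Suc i then 0
            else word_weight d A (v[i := v ! Suc i, Suc i := v ! i]) - word_weight d A v"
    have A: "A + d > 0" using Cons.prems by auto
    define s where "s = of_bool (last v = Vacancy) / (A + d * real (count_list v Particle))"
    define t where "t = of_bool (last v = Vacancy) / (A + d + d * real (count_list v Particle))"
    have "(\<Sum>i<length (x # v) - 1. ?D A (x # v) i)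
        = ?D A (x # v) 0 + (\<Sum>i<length v - 1. ?D A (x # v) (Suc i))"
      using Cons by (simp add: sum.lessThan_Suc_shift del: sum.lessThan_Suc)
    also have "(\<Sum>i<length v - 1. ?D A (x # v) (Suc i))
        = (if x = Vacancy then A * (\<Sum>i<length v - 1. ?D A v i) else (\<Sum>i<length v - 1. ?D (A + d) v i))"
      by (auto simp: sum_distrib_left algebra_simps intro!: sum.cong)
    also have "(\<Sum>i<length v - 1. ?D A v i) = word_weight d A v * d * (of_bool (hd v = Vacancy) / A
           - s)"
      unfolding s_def using Cons Cons.prems by (intro Cons.IH) auto
    also have "(\<Sum>i<length v - 1. ?D (A + d) v i)
        = word_weight d (A + d) v * d * (of_bool (hd v = Vacancy) / (A + d)
           - t)"
      unfolding t_def using Cons Cons.prems A by (intro Cons.IH) auto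
    finally have eq: "(\<Sum>i<length (x # v) - 1. ?D A (x # v) i)
        = ?D A (x # v) 0 + (if x = Vacancy
             then A * (word_weight d A v * d * (of_bool (hd v = Vacancy) / A - s))
             else word_weight d (A + d) v * d * (of_bool (hd v = Vacancy) / (A + d) - t))" .
    \<comment> \<open>The last vacancy has the same factor in the word and in its tail: a leading
      particle only moves \<open>d\<close> from the count into the parameter.\<close>
    have "of_bool (last (x # v) = Vacancy) / (A + d * real (count_list (x # v) Particle))
        = (if x = Vacancy then s else t)"
      using Cons.prems Cons by (cases x) (auto simp: s_def t_def algebra_simps)
    then show ?thesis
      unfolding eq using Cons.prems Cons A by (cases x; cases y) (simp_all add: field_simps)
  qed
qed simp

text \<open>A vacancy after the tracer passes from the beginning to the end of the environment, and
  its factor \<open>1 + q * real n\<close> becomes \<open>1 + p * real n\<close>. The exchanged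
  configuration flows in at rate \<open>q\<close>; the outflow has rate \<open>p\<close>.\<close>

lemma imbalance_first_bond:
  assumes "v \<in> words (Suc m) n" "0 \<le> q"
  shows "imbalance p q n (Tracer # v) 1 = word_weight (p - q) (1 + q * real n) v
     * of_bool (hd v = Vacancy) * (q * (1 + p * real n) / (1 + q * real n) - p)"
proof -
  obtain x w where v: "v = x # w" using assms by (cases v) (auto simp: words_def)
  have x: "x \<noteq> Tracer" "Tracer \<notin> set w" using assms v by (auto simp: words_def)
  have sw: "swap_bond 1 (Tracer # v) = [x] @ Tracer # w"
    by (simp add: v swap_bond_def next_site_def site_def Let_def)
  have pos: "0 < 1 + q * real n" using assms(2) by (auto intro!: add_pos_nonneg)
  have st: "site (Tracer # v) 1 = Tracer" "site (Tracer # v) (next_site (length (Tracer # v)) 1) = x"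
    by (auto simp: site_def next_site_def v)
  show ?thesis
  proof (cases x)
    case Vacancy
    then have "count_list w Particle = n" using assms v by (auto simp: words_def)
    then have "word_weight (p - q) (1 + q * real n) (w @ [Vacancy])
         = (1 + p * real n) * word_weight (p - q) (1 + q * real n) w"
      using x by (simp add: word_weight_snoc_Vacancy algebra_simps)
    then show ?thesis
      using pos Vacancy environment_append[of "[x]" w]
      by (simp only: imbalance_def st sw ring_weight_def)
         (simp add: v environment_Tracer_first field_simps)
  qed (use x in \<open>auto simp only: imbalance_def st sw, auto simp: v\<close>)
qed

text \<open>Mirror image of the first bond: the vacancy passes from the end to the beginning of the
  environment, and the two rates change roles.\<close>

lemma imbalance_last_bond:
  assumes "v \<in> words (Suc m) n" "0 \<le> p" "0 \<le> q"
  shows "imbalance p q n (Tracer # v) (Suc (Suc m)) = word_weight (p - q) (1 + q * real n) v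
     * of_bool (last v = Vacancy) * (p * (1 + q * real n) / (1 + p * real n) - q)"
proof -
  obtain x w where v: "v = w @ [x]" using assms by (cases v rule: rev_cases) (auto simp: words_def)
  have x: "x \<noteq> Tracer" "Tracer \<notin> set w" "length w = m" using assms v by (auto simp: words_def)
  have sw: "swap_bond (Suc (Suc m)) (Tracer # v) = (x # w) @ Tracer # []"
    using x by (simp add: v swap_bond_def next_site_def site_def Let_def nth_append list_update_append)
  have pos: "0 < 1 + p * real n" using assms(2) by (auto intro!: add_pos_nonneg)
  have st: "site (Tracer # v) (Suc (Suc m)) = x"
    "site (Tracer # v) (next_site (length (Tracer # v)) (Suc (Suc m))) = Tracer"
    using x by (auto simp: site_def next_site_def v nth_append)
  show ?thesis
  proof (cases x)
    case Vacancy
    then have "count_list w Particle = n" using assms v by (auto simp: words_def)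
    then have "word_weight (p - q) (1 + q * real n) (w @ [Vacancy])
         = (1 + p * real n) * word_weight (p - q) (1 + q * real n) w"
      using x by (simp add: word_weight_snoc_Vacancy algebra_simps)
    then show ?thesis
      using pos x Vacancy environment_append[of "x # w" "[]"]
      by (simp only: imbalance_def st sw ring_weight_def)
         (simp add: v environment_Tracer_first field_simps)
  qed (use x in \<open>auto simp only: imbalance_def st sw, auto simp: v\<close>)
qed

text \<open>Away from the tracer unequal letters exchange at rate 1 in both directions, so only the
  difference of the weights remains.\<close>

lemma imbalance_interior_bond:
  assumes "v \<in> words (Suc m) n" "k < m"
  shows "imbalance p q n (Tracer # v) (Suc (Suc k)) =
     (if v ! k = v ! Suc k then 0
      else word_weight (p - q) (1 + q * real n) (v[k := v ! Suc k, Suc k := v ! k])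
           - word_weight (p - q) (1 + q * real n) v)"
proof -
  have l: "length v = Suc m" and v_Tracer: "Tracer \<notin> set v" using assms by (auto simp: words_def)
  have T: "v ! k \<noteq> Tracer" "v ! Suc k \<noteq> Tracer"
    using assms(2) l v_Tracer by (metis Suc_less_eq less_Suc_eq nth_mem)+
  have sw: "swap_bond (Suc (Suc k)) (Tracer # v) = Tracer # v[k := v ! Suc k, Suc k := v ! k]"
    using l assms by (simp add: swap_bond_def next_site_def site_def Let_def)
  have st: "site (Tracer # v) (Suc (Suc k)) = v ! k"
    "site (Tracer # v) (next_site (length (Tracer # v)) (Suc (Suc k))) = v ! Suc k"
    using l assms by (auto simp: site_def next_site_def)
  show ?thesis
    unfolding imbalance_def st sw ring_weight_def environment_Tracer_first
    using T by (cases "v ! k"; cases "v ! Suc k") auto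
qed

lemma balance_Tracer_first:
  assumes v: "v \<in> words (Suc m) n" and pq: "0 \<le> q" "q \<le> p"
  shows "(\<Sum>i = 1..Suc (Suc m). imbalance p q n (Tracer # v) i) = 0"
proof -
  let ?W = "word_weight (p - q) (1 + q * real n) v"
  have pos: "0 < 1 + q * real n" "0 < 1 + p * real n" using pq by (auto intro!: add_pos_nonneg)
  have l: "length v = Suc m" "count_list v Particle = n" "v \<noteq> []" "Tracer \<notin> set v"
    using v by (auto simp: words_def)
  have "(\<Sum>i = 1..Suc (Suc m). imbalance p q n (Tracer # v) i)
      = imbalance p q n (Tracer # v) 1 + (\<Sum>k<m. imbalance p q n (Tracer # v) (Suc (Suc k)))
        + imbalance p q n (Tracer # v) (Suc (Suc m))"
    unfolding One_nat_def sum.atLeast1_atMost_eq[unfolded One_nat_def]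
    by (subst sum.lessThan_Suc, subst sum.lessThan_Suc_shift) simp
  also have "(\<Sum>k<m. imbalance p q n (Tracer # v) (Suc (Suc k)))
      = (\<Sum>k<length v - 1. if v ! k = v ! Suc k then 0
      else word_weight (p - q) (1 + q * real n) (v[k := v ! Suc k, Suc k := v ! k]) - ?W)"
    using l by (intro sum.cong) (auto simp: imbalance_interior_bond[OF v])
  also have "\<dots> = ?W * (p - q) * (of_bool (hd v = Vacancy) / (1 + q * real n)
           - of_bool (last v = Vacancy) / (1 + q * real n + (p - q) * real n))"
    using interior_swaps[of v "1 + q * real n" "p - q"] l pos pq by simp
  also have "1 + q * real n + (p - q) * real n = 1 + p * real n" by (simp add: algebra_simps)
  \<comment> \<open>\<open>q * (1 + p * real n) / (1 + q * real n) - p\<close> equals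
    \<open>- (p - q) / (1 + q * real n)\<close>, and the coefficient of the last bond is
    \<open>(p - q) / (1 + p * real n)\<close>. They cancel the two boundary terms.\<close>
  also have "imbalance p q n (Tracer # v) 1 + ?W * (p - q) * (of_bool (hd v = Vacancy) / (1 + q * real n)
           - of_bool (last v = Vacancy) / (1 + p * real n)) + imbalance p q n (Tracer # v) (Suc (Suc m)) = 0"
    unfolding imbalance_first_bond[OF v pq(1)] imbalance_last_bond[OF v order_trans[OF pq] pq(1)]
    using pos by (auto simp: field_simps)
  finally show ?thesis .
qed

section \<open>Rotation invariance and balance at every configuration\<close>

lemma environment_rotate1:
  assumes "\<eta> \<in> configs L n"
  shows "environment (rotate1 \<eta>) = environment \<eta>"
proof -
  obtain u v where uv: "\<eta> = u @ Tracer # v" "v @ u \<in> words (L - 1) n"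
    using configs_split[OF assms] .
  then have T: "Tracer \<notin> set u" "Tracer \<notin> set v" by (auto simp: words_def)
  show ?thesis
  proof (cases u)
    case Nil
    then show ?thesis using T uv environment_append[of v "[]"] environment_Tracer_first by simp
  next
    case (Cons x w)
    then show ?thesis
      using T uv environment_append[of w "v @ [x]"] environment_append[of u v] by simp
  qed
qed

lemma site_rotate1:
  assumes "1 \<le> i" "i \<le> length \<eta>"
  shows "site (rotate1 \<eta>) i = site \<eta> (next_site (length \<eta>) i)"
  using assms nth_rotate1[of "i - 1" \<eta>] by (auto simp: site_def next_site_def)

lemma swap_bond_rotate1:
  assumes "1 \<le> i" "i \<le> length \<eta>"
  shows "swap_bond i (rotate1 \<eta>) = rotate1 (swap_bond (next_site (length \<eta>) i) \<eta>)"
proof (rule nth_equalityI)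
  let ?L = "length \<eta>" and ?i = "next_site (length \<eta>) i"
  let ?j = "next_site ?L ?i"
  have r: "1 \<le> ?i" "?i \<le> ?L" "1 \<le> ?j" "?j \<le> ?L" using assms by (auto simp: next_site_def)
  then show "length (swap_bond i (rotate1 \<eta>)) = length (rotate1 (swap_bond ?i \<eta>))"
    using assms by (simp add: length_swap_bond)
  fix k assume "k < length (swap_bond i (rotate1 \<eta>))"
  then have k: "k < ?L" using assms by (simp add: length_swap_bond)
  \<comment> \<open>The cyclic successor is injective; \<open>k\<close> counts from 0 and
    \<open>l\<close> from 1.\<close>
  have inj: "Suc k mod ?L = next_site ?L l - 1 \<longleftrightarrow> k = l - 1" if "1 \<le> l" "l \<le> ?L" for l
    using that k by (cases "Suc k = ?L") (auto simp: next_site_def)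
  have "swap_bond i (rotate1 \<eta>) ! k
      = (if k = ?i - 1 then site \<eta> ?i else if k = i - 1 then site \<eta> ?j else \<eta> ! (Suc k mod ?L))"
    using k assms r
    by (simp add: swap_bond_def Let_def nth_list_update nth_rotate1 site_rotate1)
  moreover have "rotate1 (swap_bond ?i \<eta>) ! k
      = (if Suc k mod ?L = ?j - 1 then site \<eta> ?i else if Suc k mod ?L = ?i - 1 then site \<eta> ?j
         else \<eta> ! (Suc k mod ?L))"
  proof -
    have "Suc k mod ?L < ?L" using k by (intro mod_less_divisor) linarith
    then show ?thesis
      using k r by (simp add: nth_rotate1 length_swap_bond)
        (simp add: swap_bond_def Let_def nth_list_update)
  qed
  ultimately show "swap_bond i (rotate1 \<eta>) ! k = rotate1 (swap_bond ?i \<eta>) ! k"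
    using inj[of i] inj[of ?i] assms r by simp
qed

lemma rotate1_in_configs: "rotate1 \<eta> \<in> configs L n \<longleftrightarrow> \<eta> \<in> configs L n"
  by (rule configs_mset) (cases \<eta>; simp)

lemma balance_rotate1:
  assumes \<eta>: "\<eta> \<in> configs L n" and L: "2 \<le> L"
  shows "(\<Sum>i = 1..L. imbalance p q n (rotate1 \<eta>) i) = (\<Sum>i = 1..L. imbalance p q n \<eta> i)"
proof -
  have l: "length \<eta> = L" using \<eta> by (rule configs_length)
  have "(\<Sum>i = 1..L. imbalance p q n (rotate1 \<eta>) i)
      = (\<Sum>i = 1..L. imbalance p q n \<eta> (next_site L i))"
  proof (intro sum.cong refl)
    fix i assume "i \<in> {1..L}"
    then have i: "1 \<le> i" "i \<le> L" and n: "1 \<le> next_site L i" "next_site L i \<le> L"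
      by (auto simp: next_site_def)
    show "imbalance p q n (rotate1 \<eta>) i = imbalance p q n \<eta> (next_site L i)"
      using i n l \<eta> swap_bond_in_configs[OF \<eta> n]
      by (simp add: imbalance_def site_rotate1 swap_bond_rotate1 ring_weight_def environment_rotate1)
  qed
  also have "\<dots> = (\<Sum>i = 1..L. imbalance p q n \<eta> i)"
    using L
    by (intro sum.reindex_bij_witness[where j = "next_site L" and
          i = "\<lambda>i. if i = 1 then L else i - 1"]) (auto simp: next_site_def)
  finally show ?thesis .
qed

text \<open>Each rotation shortens the word in front of the tracer by one letter, so induction on
  that word ends with the tracer first.\<close>

lemma configs_rotate_induct [consumes 1, case_names Tracer_first rotate1]:
  assumes "\<eta> \<in> configs L n"
    and "\<And>v. v \<in> words (L - 1) n \<Longrightarrow> P (Tracer # v)"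
    and "\<And>\<eta>. \<eta> \<in> configs L n \<Longrightarrow> P (rotate1 \<eta>) \<Longrightarrow> P \<eta>"
  shows "P \<eta>"
proof -
  have "\<eta> \<in> configs L n \<Longrightarrow> \<eta> = u @ Tracer # v \<Longrightarrow> P \<eta>" for u v
  proof (induction u arbitrary: \<eta> v)
    case Nil
    then have "v \<in> words (L - 1) n"
      by (auto simp: configs_def words_def count_list_0_iff)
    then show ?case using Nil assms(2) by simp
  next
    case (Cons x u)
    have "P (rotate1 \<eta>)"
      using Cons.prems rotate1_in_configs[of "x # u @ Tracer # v"]
      by (intro Cons.IH[of _ "v @ [x]"]) auto
    then show ?case using Cons assms(3) by blast
  qed
  moreover obtain u v where "\<eta> = u @ Tracer # v" using configs_split[OF assms(1)] .
  ultimately show ?thesis using assms(1) by blast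
qed

lemma balance_ring:
  assumes "\<eta> \<in> configs L n" "2 \<le> L" "0 \<le> q" "q \<le> p"
  shows "(\<Sum>i = 1..L. imbalance p q n \<eta> i) = 0"
  using assms(1)
proof (induction rule: configs_rotate_induct)
  case (Tracer_first v)
  obtain m where "L = Suc (Suc m)" using le_Suc_ex[OF assms(2)] by auto
  then show ?case using balance_Tracer_first[of v m n q p] assms(3,4) Tracer_first by simp
next
  case (rotate1 \<eta>)
  then show ?case using balance_rotate1[OF rotate1.hyps assms(2)] by simp
qed

section \<open>From flows through bonds to global balance\<close>

lemma sum_rate_from:
  assumes "\<eta> \<in> configs L n"
  shows "(\<Sum>\<xi>\<in>configs L n. rate p q \<eta> \<xi>)
       = (\<Sum>i = 1..L. swap_rate p q (site \<eta> i) (site \<eta> (next_site L i)))"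
  unfolding rate_def configs_length[OF assms]
  by (subst sum.swap) (auto intro!: sum.cong simp: sum.delta swap_bond_in_configs[OF assms])

text \<open>Since exchanges are involutions, the sum over predecessors becomes a sum over
  bonds.\<close>

lemma sum_rate_into:
  assumes "\<eta> \<in> configs L n"
  shows "(\<Sum>\<xi>\<in>configs L n. f \<xi> * rate p q \<xi> \<eta>)
       = (\<Sum>i = 1..L. f (swap_bond i \<eta>) * swap_rate p q (site \<eta> (next_site L i)) (site \<eta> i))"
proof -
  have "(\<Sum>\<xi>\<in>configs L n. f \<xi> * rate p q \<xi> \<eta>)
      = (\<Sum>\<xi>\<in>configs L n. \<Sum>i = 1..L. if \<xi> = swap_bond i \<eta>
           then f (swap_bond i \<eta>) * swap_rate p q (site \<eta> (next_site L i)) (site \<eta> i) else 0)"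
  proof (intro sum.cong refl)
    fix \<xi> assume \<xi>: "\<xi> \<in> configs L n"
    have "\<eta> = swap_bond i \<xi> \<longleftrightarrow> \<xi> = swap_bond i \<eta>" if "i \<in> {1..L}" for i
      using that \<xi> assms swap_bond_swap_bond[of i \<xi>] swap_bond_swap_bond[of i \<eta>]
      by (auto simp: configs_length)
    moreover have "site (swap_bond i \<eta>) i = site \<eta> (next_site L i)"
      "site (swap_bond i \<eta>) (next_site L i) = site \<eta> i" if "i \<in> {1..L}" for i
      using that assms site_swap_bond[of i \<eta>] site_next_swap_bond[of i \<eta>]
      by (auto simp: configs_length)
    ultimately show "f \<xi> * rate p q \<xi> \<eta> = (\<Sum>i = 1..L. if \<xi> = swap_bond i \<eta>
           then f (swap_bond i \<eta>) * swap_rate p q (site \<eta> (next_site L i)) (site \<eta> i) else 0)"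
      unfolding rate_def sum_distrib_left configs_length[OF \<xi>]
      by (intro sum.cong refl) auto
  qed
  also have "\<dots> = (\<Sum>i = 1..L. f (swap_bond i \<eta>) * swap_rate p q (site \<eta> (next_site L i)) (site \<eta> i))"
    by (subst sum.swap) (auto intro!: sum.cong simp: sum.delta' sum.delta swap_bond_in_configs[OF assms])
  finally show ?thesis .
qed

lemma ring_weight_balance:
  assumes "\<eta> \<in> configs L n" "2 \<le> L" "0 \<le> q" "q \<le> p"
  shows "(\<Sum>\<xi>\<in>configs L n. ring_weight p q n \<xi> * rate p q \<xi> \<eta>)
       = ring_weight p q n \<eta> * (\<Sum>\<xi>\<in>configs L n. rate p q \<eta> \<xi>)"
  using balance_ring[OF assms]
  unfolding sum_rate_into[OF assms(1)] sum_rate_from[OF assms(1)] imbalance_def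
    configs_length[OF assms(1)]
  by (simp add: sum_subtractf sum_distrib_left)

section \<open>Uniqueness of the steady state\<close>

text \<open>Maximum principle: the points where \<open>\<nu> / \<mu>\<close> attains its maximum
  form a nonempty set closed under predecessors, so \<open>c\<close> is one of them by
  \<open>reach\<close>.\<close>

lemma balanced_le_at:
  fixes K :: "'a \<Rightarrow> 'a \<Rightarrow> real"
  assumes S: "finite S" "c \<in> S"
    and pos: "\<And>x. x \<in> S \<Longrightarrow> 0 < \<mu> x" and K: "\<And>x y. 0 \<le> K x y"
    and \<mu>: "\<And>y. y \<in> S \<Longrightarrow> (\<Sum>x\<in>S. \<mu> x * K x y) = \<mu> y * (\<Sum>x\<in>S. K y x)"
    and \<nu>: "\<And>y. y \<in> S \<Longrightarrow> (\<Sum>x\<in>S. \<nu> x * K x y) = \<nu> y * (\<Sum>x\<in>S. K y x)"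
    and reach: "\<And>M. M \<subseteq> S \<Longrightarrow> M \<noteq> {} \<Longrightarrow>
        (\<And>x y. y \<in> M \<Longrightarrow> x \<in> S \<Longrightarrow> 0 < K x y \<Longrightarrow> x \<in> M) \<Longrightarrow> c \<in> M"
    and x: "x \<in> S"
  shows "\<nu> x \<le> \<nu> c / \<mu> c * \<mu> x"
proof -
  define m where "m = Max ((\<lambda>x. \<nu> x / \<mu> x) ` S)"
  have le: "\<nu> x \<le> m * \<mu> x" if "x \<in> S" for x
  proof -
    have "\<nu> x / \<mu> x \<le> m" unfolding m_def using S that by (intro Max_ge) auto
    then show ?thesis using pos[OF that] by (simp add: divide_le_eq)
  qed
  let ?M = "{x \<in> S. \<nu> x = m * \<mu> x}"
  have "m \<in> (\<lambda>x. \<nu> x / \<mu> x) ` S" unfolding m_def using S by (intro Max_in) auto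
  then obtain x0 where x0: "x0 \<in> S" "m = \<nu> x0 / \<mu> x0" by blast
  have "c \<in> ?M"
  proof (rule reach)
    have "x0 \<in> ?M" using x0 pos[OF x0(1)] by simp
    then show "?M \<noteq> {}" by blast
    fix x y assume y: "y \<in> ?M" and x: "x \<in> S" "0 < K x y"
    have "(\<Sum>x\<in>S. (m * \<mu> x - \<nu> x) * K x y)
        = m * (\<Sum>x\<in>S. \<mu> x * K x y) - (\<Sum>x\<in>S. \<nu> x * K x y)"
      by (simp add: sum_subtractf sum_distrib_left algebra_simps)
    \<comment> \<open>At a maximizer \<open>y\<close> the two outflows agree. The summands are
      nonnegative, so each is 0 and every predecessor is a maximizer too.\<close>
    also have "\<dots> = 0" using y \<mu> \<nu> by simp
    finally have "\<forall>x\<in>S. (m * \<mu> x - \<nu> x) * K x y = 0"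
      using S le K by (subst (asm) sum_nonneg_eq_0_iff) auto
    then show "x \<in> ?M" using x by force
  qed auto
  then show ?thesis using le[OF x] pos[OF S(2)] by simp
qed

text \<open>The upper bound for \<open>\<nu>\<close> and for its negative gives equality.\<close>

lemma balanced_proportional:
  fixes K :: "'a \<Rightarrow> 'a \<Rightarrow> real"
  assumes "finite S" "c \<in> S"
    and "\<And>x. x \<in> S \<Longrightarrow> 0 < \<mu> x" and "\<And>x y. 0 \<le> K x y"
    and "\<And>y. y \<in> S \<Longrightarrow> (\<Sum>x\<in>S. \<mu> x * K x y) = \<mu> y * (\<Sum>x\<in>S. K y x)"
    and \<nu>: "\<And>y. y \<in> S \<Longrightarrow> (\<Sum>x\<in>S. \<nu> x * K x y) = \<nu> y * (\<Sum>x\<in>S. K y x)"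
    and "\<And>M. M \<subseteq> S \<Longrightarrow> M \<noteq> {} \<Longrightarrow>
        (\<And>x y. y \<in> M \<Longrightarrow> x \<in> S \<Longrightarrow> 0 < K x y \<Longrightarrow> x \<in> M) \<Longrightarrow> c \<in> M"
    and "x \<in> S"
  shows "\<nu> x = \<nu> c / \<mu> c * \<mu> x"
proof (rule antisym)
  show "\<nu> x \<le> \<nu> c / \<mu> c * \<mu> x"
    using assms by (rule balanced_le_at)
  have "(\<Sum>x\<in>S. - \<nu> x * K x y) = - \<nu> y * (\<Sum>x\<in>S. K y x)" if "y \<in> S" for y
    using \<nu>[OF that] by (simp add: sum_negf)
  with assms(1-5) have "- \<nu> x \<le> - \<nu> c / \<mu> c * \<mu> x"
    using assms(7,8) by (rule balanced_le_at[where \<nu> = "\<lambda>x. - \<nu> x"])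
  then show "\<nu> c / \<mu> c * \<mu> x \<le> \<nu> x" by simp
qed

section \<open>Irreducibility by sets closed under predecessors\<close>

lemma swap_bond_append:
  "swap_bond (Suc (length x)) (x @ a # b # y) = x @ b # a # y"
  by (simp add: swap_bond_def next_site_def site_def Let_def nth_append list_update_append)

lemma swap_bond_wrap: "swap_bond (Suc (Suc (length x))) (a # x @ [b]) = b # x @ [a]"
  by (simp add: swap_bond_def next_site_def site_def Let_def nth_append list_update_append)

lemma swap_rate_sym_pos: "a \<noteq> Tracer \<Longrightarrow> b \<noteq> Tracer \<Longrightarrow> a \<noteq> b \<Longrightarrow> 0 < swap_rate p q a b"
  by (cases a; cases b) auto

lemma length_eq_count_letters:
  "length v = count_list v Particle + count_list v Vacancy + count_list v Tracer"
proof (induction v)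
  case (Cons x v)
  then show ?case by (cases x) auto
qed simp

text \<open>Moves are followed backwards: the rate is that of the exchange from
  \<open>swap_bond i \<eta>\<close> to \<open>\<eta>\<close>.\<close>

definition pred_closed :: "real \<Rightarrow> real \<Rightarrow> nat \<Rightarrow> letter list set \<Rightarrow> bool" where
  "pred_closed p q L M \<longleftrightarrow> (\<forall>\<eta>\<in>M. \<forall>i. 1 \<le> i \<longrightarrow> i \<le> L \<longrightarrow>
     0 < swap_rate p q (site \<eta> (next_site L i)) (site \<eta> i) \<longrightarrow> swap_bond i \<eta> \<in> M)"

context
  fixes p q :: real and L n :: nat and M :: "letter list set"
  assumes M: "M \<subseteq> configs L n" and closed: "pred_closed p q L M"
begin

lemma closed_swap_bond:
  assumes "x @ a # b # y \<in> M" "0 < swap_rate p q b a"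
  shows "x @ b # a # y \<in> M"
proof -
  have l: "length (x @ a # b # y) = L" using assms M configs_length by blast
  have "site (x @ a # b # y) (next_site L (Suc (length x))) = b"
    "site (x @ a # b # y) (Suc (length x)) = a"
    using l by (auto simp: site_def next_site_def nth_append)
  then have "swap_bond (Suc (length x)) (x @ a # b # y) \<in> M"
    using closed assms l unfolding pred_closed_def by auto
  then show ?thesis by (simp add: swap_bond_append)
qed

text \<open>This is the bond from the last site to the first.\<close>

lemma closed_wrap:
  assumes "a # x @ [b] \<in> M" "0 < swap_rate p q a b"
  shows "b # x @ [a] \<in> M"
proof -
  have l: "length (a # x @ [b]) = L" using assms M configs_length by blast
  then have "site (a # x @ [b]) (next_site L (Suc (Suc (length x)))) = a"
    "site (a # x @ [b]) (Suc (Suc (length x))) = b"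
    by (auto simp: site_def next_site_def nth_append)
  then have "swap_bond (Suc (Suc (length x))) (a # x @ [b]) \<in> M"
    using closed assms l unfolding pred_closed_def by auto
  then show ?thesis by (simp add: swap_bond_wrap)
qed

lemma closed_swap:
  assumes "x @ a # b # y \<in> M" "a \<noteq> Tracer" "b \<noteq> Tracer"
  shows "x @ b # a # y \<in> M"
  using assms closed_swap_bond swap_rate_sym_pos by (cases "a = b") auto

lemma closed_bubble:
  assumes "x @ u @ a # y \<in> M" "a \<noteq> Tracer" "Tracer \<notin> set u"
  shows "x @ a # u @ y \<in> M"
  using assms
proof (induction u arbitrary: x)
  case (Cons b u)
  have "(x @ [b]) @ a # u @ y \<in> M" using Cons.prems by (intro Cons.IH) auto
  then show ?case using closed_swap[of x b a "u @ y"] Cons.prems by auto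
qed simp

text \<open>Ordinary particles and vacancies exchange freely, so the letters of \<open>w\<close> can
  be brought to the front one after another.\<close>

lemma closed_permute:
  assumes "x @ u @ y \<in> M" "mset u = mset w" "Tracer \<notin> set u"
  shows "x @ w @ y \<in> M"
  using assms
proof (induction w arbitrary: x u)
  case (Cons a w)
  then have "a \<in> set u" by (metis list.set_intros(1) mset_eq_setD)
  then obtain s t where u: "u = s @ a # t" by (meson split_list)
  have "x @ a # s @ t @ y \<in> M"
    using Cons.prems u by - (rule closed_bubble, auto)
  then have "(x @ [a]) @ w @ y \<in> M"
    using Cons.prems u by (intro Cons.IH[of "x @ [a]" "s @ t"]) auto
  then show ?case by simp
qed simp

text \<open>Induction on the number of sites before the tracer. A vacancy among them is brought next
  to the tracer, whose last move, made at rate \<open>p > 0\<close>, is then undone; this shortens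
  the prefix.\<close>

lemma closed_Tracer_first:
  assumes "0 < p" "n + 2 \<le> L" "u @ Tracer # v \<in> M"
  shows "\<exists>w. Tracer # w \<in> M"
  using assms(3)
proof (induction "length u" arbitrary: u v)
  case (Suc k)
  have cfg: "u @ Tracer # v \<in> configs L n" using Suc M by blast
  then have T: "Tracer \<notin> set u" "Tracer \<notin> set v" by (auto simp: configs_def count_list_0_iff)
  have step: "\<exists>w. Tracer # w \<in> M"
    if "u' @ Tracer # v' \<in> M" "Vacancy \<in> set u'" "length u' = Suc k" "Tracer \<notin> set u'" for u' v'
  proof -
    obtain s t where st: "u' = s @ Vacancy # t" using \<open>Vacancy \<in> set u'\<close> by (meson split_list)
    have "[] @ (s @ t @ [Vacancy]) @ Tracer # v' \<in> M"
      using that by - (rule closed_permute[of "[]" u'], auto simp: st)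
    then have "(s @ t) @ Tracer # Vacancy # v' \<in> M"
      using closed_swap_bond[of "s @ t" Vacancy Tracer v'] \<open>0 < p\<close> by simp
    then show ?thesis using that st Suc.hyps(1)[of "s @ t" "Vacancy # v'"] by simp
  qed
  show ?case
  proof (cases "Vacancy \<in> set u")
    case True
    then show ?thesis using step Suc T by auto
  next
    case False
    obtain x s where u: "u = x # s" using Suc by (cases u) auto
    then have x: "x = Particle" using False T by (cases x) auto
    \<comment> \<open>As \<open>n + 2 \<le> L\<close>, there is a vacancy, here behind the tracer.
      It goes to the last site and is exchanged around the ring with the particle at site 1.\<close>
    have "count_list (u @ Tracer # v) Vacancy > 0"
      using cfg length_eq_count_letters[of "u @ Tracer # v"] assms(2) unfolding configs_def by auto
    then have "Vacancy \<in> set v" using False by (intro ccontr[of "Vacancy \<in> set v"]) simp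
    then obtain s' t' where v: "v = s' @ Vacancy # t'" by (meson split_list)
    have "(u @ [Tracer]) @ (s' @ t' @ [Vacancy]) @ [] \<in> M"
      using Suc.prems T by - (rule closed_permute[of "u @ [Tracer]" v], auto simp: v)
    then have "Particle # (s @ Tracer # s' @ t') @ [Vacancy] \<in> M"
      by (simp add: u x)
    then have "Vacancy # (s @ Tracer # s' @ t') @ [Particle] \<in> M"
      by (rule closed_wrap) simp
    then show ?thesis
      using step[of "Vacancy # s" "s' @ t' @ [Particle]"] Suc.hyps(2) u T by simp
  qed
qed auto

lemma closed_contains:
  assumes "0 < p" "n + 2 \<le> L" "M \<noteq> {}"
  shows "Tracer # replicate n Particle @ replicate (L - n - 1) Vacancy \<in> M"
proof -
  obtain \<eta> where \<eta>: "\<eta> \<in> M" using assms by blast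
  then obtain u v where "\<eta> = u @ Tracer # v" using M configs_split by blast
  then obtain w where w: "Tracer # w \<in> M" using closed_Tracer_first assms \<eta> by blast
  then have cfg: "Tracer # w \<in> configs L n" using M by blast
  then have c: "count_list w Tracer = 0" "count_list w Particle = n" "Tracer \<notin> set w"
    by (auto simp: configs_def count_list_0_iff)
  then have "count_list w Vacancy = L - n - 1"
    using length_eq_count_letters[of w] configs_length[OF cfg] by simp
  then have "mset w = mset (replicate n Particle @ replicate (L - n - 1) Vacancy)"
    using c by (intro multiset_eqI, rename_tac x, case_tac x) (simp_all add: count_mset)
  then show ?thesis
    using closed_permute[of "[Tracer]" w "[]"] w c by simp
qed

end

section \<open>Positivity of rates and proportionality of stationary measures\<close>

lemma swap_rate_nonneg: "0 \<le> p \<Longrightarrow> 0 \<le> q \<Longrightarrow> 0 \<le> swap_rate p q a b"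
  by (cases a; cases b) auto

lemma rate_nonneg: "0 \<le> p \<Longrightarrow> 0 \<le> q \<Longrightarrow> 0 \<le> rate p q \<eta> \<xi>"
  unfolding rate_def by (intro sum_nonneg) (auto simp: swap_rate_nonneg)

text \<open>Different bonds may give the same exchange, so the rate is bounded below by its term for
  bond \<open>i\<close>.\<close>

lemma rate_swap_bond_pos:
  assumes "1 \<le> i" "i \<le> length \<eta>" "0 \<le> p" "0 \<le> q"
    and "0 < swap_rate p q (site \<eta> (next_site (length \<eta>) i)) (site \<eta> i)"
  shows "0 < rate p q (swap_bond i \<eta>) \<eta>"
proof -
  have "swap_rate p q (site \<eta> (next_site (length \<eta>) i)) (site \<eta> i) \<le> rate p q (swap_bond i \<eta>) \<eta>"
    unfolding rate_def length_swap_bond[OF assms(1,2)]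
    using assms by (intro order_trans[OF _ member_le_sum[where i = i]])
      (auto simp: swap_bond_swap_bond site_swap_bond site_next_swap_bond swap_rate_nonneg)
  then show ?thesis using assms(5) by linarith
qed

lemma ring_weight_pos: "0 \<le> q \<Longrightarrow> q \<le> p \<Longrightarrow> 0 < ring_weight p q n \<eta>"
  unfolding ring_weight_def by (intro word_weight_pos) (auto intro: add_pos_nonneg)

lemma stationary_proportional_ring_weight:
  assumes "0 \<le> q" "q \<le> p" "0 < p" "n + 2 \<le> L" and st: "stationary p q L n \<pi>"
  shows "\<exists>C. \<forall>\<eta>\<in>configs L n. pmf \<pi> \<eta> = C * ring_weight p q n \<eta>"
proof -
  let ?c = "Tracer # replicate n Particle @ replicate (L - n - 1) Vacancy"
  have cl: "?c \<in> M" if "M \<subseteq> configs L n" "M \<noteq> {}"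
    and "\<And>x y. y \<in> M \<Longrightarrow> x \<in> configs L n \<Longrightarrow> 0 < rate p q x y \<Longrightarrow> x \<in> M" for M
  proof (rule closed_contains)
    show "pred_closed p q L M"
      unfolding pred_closed_def
    proof (intro ballI allI impI)
      fix \<eta> i assume \<eta>: "\<eta> \<in> M" and i: "1 \<le> i" "i \<le> L"
        and "0 < swap_rate p q (site \<eta> (next_site L i)) (site \<eta> i)"
      moreover have "\<eta> \<in> configs L n" using \<eta> that by blast
      ultimately show "swap_bond i \<eta> \<in> M"
        using assms that(3) rate_swap_bond_pos[of i \<eta> p q] swap_bond_in_configs[of \<eta> L n i]
        by (auto simp: configs_length)
    qed
  qed (use assms that in auto)
  have "pmf \<pi> \<eta> = pmf \<pi> ?c / ring_weight p q n ?c * ring_weight p q n \<eta>"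
    if "\<eta> \<in> configs L n" for \<eta>
  proof (rule balanced_proportional[where S = "configs L n" and K = "rate p q"])
    \<comment> \<open>Here \<open>cl\<close> is applied to the whole configuration space.\<close>
    show "?c \<in> configs L n" using assms(4) by (intro cl) (use that in auto)
    show "(\<Sum>x\<in>configs L n. pmf \<pi> x * rate p q x y) = pmf \<pi> y * (\<Sum>x\<in>configs L n. rate p q y x)"
      if "y \<in> configs L n" for y
      using st that by (auto simp: stationary_def)
  qed (use assms that cl in \<open>auto intro: ring_weight_balance ring_weight_pos rate_nonneg\<close>)
  then show ?thesis by blast
qed

section \<open>Normalization\<close>

lemma inj_rotate1: "inj_on rotate1 S"
proof (rule inj_onI)
  fix x y :: "'a list" assume "rotate1 x = rotate1 y"
  then show "x = y" by (cases x; cases y) auto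
qed

lemma rotate1_configs: "rotate1 ` configs L n = configs L n"
  by (rule endo_inj_surj) (auto simp: rotate1_in_configs inj_rotate1)

text \<open>Rotation carries the tracer from site \<open>i + 1\<close> to site \<open>i\<close> and
  preserves the weight, so the sum is the same for every site.\<close>

lemma sum_ring_weight_Tracer_at:
  assumes "1 \<le> i" "i \<le> L"
  shows "(\<Sum>\<eta> | \<eta> \<in> configs L n \<and> site \<eta> i = Tracer. ring_weight p q n \<eta>) = brace p q L (n + 1)"
  using assms
proof (induction i rule: dec_induct)
  case base
  then obtain N where N: "L = Suc N" by (cases L) auto
  show ?case
    unfolding N configs_Tracer_first
    by (simp add: sum.reindex brace_eq_sum_words ring_weight_def environment_Tracer_first)
next
  case (step i)
  have "(\<Sum>\<eta> | \<eta> \<in> configs L n \<and> site \<eta> (Suc i) = Tracer. ring_weight p q n \<eta>)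
      = (\<Sum>\<eta>\<in>rotate1 ` {\<eta>. \<eta> \<in> configs L n \<and> site \<eta> (Suc i) = Tracer}. ring_weight p q n \<eta>)"
    by (subst sum.reindex)
       (auto simp: inj_rotate1 ring_weight_def environment_rotate1 intro!: sum.cong)
  also have "rotate1 ` {\<eta>. \<eta> \<in> configs L n \<and> site \<eta> (Suc i) = Tracer}
      = {\<eta>. \<eta> \<in> configs L n \<and> site \<eta> i = Tracer}"
  proof -
    have "site (rotate1 \<eta>) i = site \<eta> (Suc i)" if "\<eta> \<in> configs L n" for \<eta>
      using that step by (simp add: site_rotate1 configs_length next_site_def)
    then show ?thesis
      using rotate1_configs[of L n] by (auto simp: image_iff) (metis imageE)
  qed
  finally show ?case using step by simp
qed

lemma configs_Tracer_unique:
  assumes "\<eta> \<in> configs L n"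
  shows "(\<Sum>i = 1..L. of_bool (site \<eta> i = Tracer)) = (1 :: real)"
proof -
  have "(\<Sum>i = 1..L. of_bool (site \<eta> i = Tracer)) = (\<Sum>k<L. of_bool (\<eta> ! k = Tracer) :: real)"
    by (simp add: sum.atLeast1_atMost_eq[unfolded One_nat_def] site_def)
  also have "\<dots> = real (card {k. k < length \<eta> \<and> \<eta> ! k = Tracer})"
    using configs_length[OF assms] by (simp add: Int_def)
  finally show ?thesis
    using assms by (simp only: count_list_eq_card[symmetric] configs_def) simp
qed

text \<open>Each configuration has one tracer; splitting by its site gives \<open>L\<close> equal
  sums.\<close>

lemma sum_ring_weight: "(\<Sum>\<eta>\<in>configs L n. ring_weight p q n \<eta>) = Z p q L n"
proof -
  have "(\<Sum>\<eta>\<in>configs L n. ring_weight p q n \<eta>)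
      = (\<Sum>\<eta>\<in>configs L n. \<Sum>i = 1..L. of_bool (site \<eta> i = Tracer) * ring_weight p q n \<eta>)"
    by (intro sum.cong refl) (simp only: sum_distrib_right[symmetric] configs_Tracer_unique mult_1)
  also have "\<dots> = (\<Sum>i = 1..L. \<Sum>\<eta>\<in>configs L n. of_bool (site \<eta> i = Tracer) * ring_weight p q n \<eta>)"
    by (rule sum.swap)
  also have "\<dots> = (\<Sum>i = 1..L. \<Sum>\<eta> | \<eta> \<in> configs L n \<and> site \<eta> i = Tracer. ring_weight p q n \<eta>)"
    by (rule sum.cong[OF refl]) (simp add: Int_def)
  also have "\<dots> = Z p q L n"
    by (simp add: sum_ring_weight_Tracer_at Z_def)
  finally show ?thesis .
qed

section \<open>The normalized weight as the steady state\<close>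

definition product_pmf :: "real \<Rightarrow> real \<Rightarrow> nat \<Rightarrow> nat \<Rightarrow> letter list pmf" where
  "product_pmf p q L n =
     embed_pmf (\<lambda>\<eta>. if \<eta> \<in> configs L n then ring_weight p q n \<eta> / Z p q L n else 0)"

lemma configs_nonempty:
  assumes "n + 1 \<le> L"
  shows "configs L n \<noteq> {}"
proof -
  have "Tracer # replicate n Particle @ replicate (L - n - 1) Vacancy \<in> configs L n"
    using assms by (simp add: configs_def count_mset[symmetric])
  then show ?thesis by blast
qed

lemma Z_pos:
  assumes "n + 1 \<le> L" "0 \<le> q" "q \<le> p"
  shows "0 < Z p q L n"
  unfolding sum_ring_weight[symmetric]
  using assms configs_nonempty by (intro sum_pos) (auto intro: ring_weight_pos)

lemma pmf_product_pmf:
  assumes "n + 1 \<le> L" "0 \<le> q" "q \<le> p"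
  shows "pmf (product_pmf p q L n) \<eta> =
    (if \<eta> \<in> configs L n then ring_weight p q n \<eta> / Z p q L n else 0)"
  unfolding product_pmf_def
proof (rule pmf_embed_pmf)
  let ?f = "\<lambda>\<eta>. if \<eta> \<in> configs L n then ring_weight p q n \<eta> / Z p q L n else 0"
  show nn: "0 \<le> ?f \<eta>" for \<eta>
    using Z_pos[OF assms] ring_weight_pos[OF assms(2,3)] by (auto intro: less_imp_le)
  have "(\<integral>\<^sup>+ \<eta>. ennreal (?f \<eta>) \<partial>count_space UNIV)
      = (\<Sum>\<eta>\<in>configs L n. ennreal (?f \<eta>))"
    by (rule nn_integral_count_space') (auto split: if_splits)
  also have "\<dots> = ennreal (\<Sum>\<eta>\<in>configs L n. ?f \<eta>)"
    using nn by (rule sum_ennreal)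
  also have "(\<Sum>\<eta>\<in>configs L n. ?f \<eta>) = 1"
    using Z_pos[OF assms] by (simp add: sum_divide_distrib[symmetric] sum_ring_weight)
  finally show "(\<integral>\<^sup>+ \<eta>. ennreal (?f \<eta>) \<partial>count_space UNIV) = 1" by simp
qed

lemma stationary_product_pmf:
  assumes "n + 2 \<le> L" "0 \<le> q" "q \<le> p"
  shows "stationary p q L n (product_pmf p q L n)"
proof -
  have pmf: "pmf (product_pmf p q L n) \<eta> =
    (if \<eta> \<in> configs L n then ring_weight p q n \<eta> / Z p q L n else 0)" for \<eta>
    using assms by (intro pmf_product_pmf) auto
  have "(\<Sum>\<xi>\<in>configs L n. ring_weight p q n \<xi> / Z p q L n * rate p q \<xi> \<eta>)
      = ring_weight p q n \<eta> / Z p q L n * (\<Sum>\<xi>\<in>configs L n. rate p q \<eta> \<xi>)"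
    if "\<eta> \<in> configs L n" for \<eta>
    using ring_weight_balance[OF that, of q p] assms
    by (simp add: sum_divide_distrib[symmetric])
  moreover have "set_pmf (product_pmf p q L n) \<subseteq> configs L n"
    by (auto simp: set_pmf_eq pmf split: if_splits)
  ultimately show ?thesis by (simp add: stationary_def pmf)
qed

lemma stationary_unique:
  assumes "n + 2 \<le> L" "0 \<le> q" "q \<le> p" "0 < p" and st: "stationary p q L n \<pi>"
  shows "\<pi> = product_pmf p q L n"
proof (rule pmf_eqI)
  fix \<eta>
  obtain C where C: "\<And>\<eta>. \<eta> \<in> configs L n \<Longrightarrow> pmf \<pi> \<eta> = C * ring_weight p q n \<eta>"
    using stationary_proportional_ring_weight assms by meson
  have supp: "set_pmf \<pi> \<subseteq> configs L n" using st by (simp add: stationary_def)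
  then have "1 = (\<Sum>\<eta>\<in>configs L n. pmf \<pi> \<eta>)"
    by (simp add: sum_pmf_eq_1)
  also have "\<dots> = C * Z p q L n"
    by (simp add: C sum_distrib_left[symmetric] sum_ring_weight)
  finally have "C = 1 / Z p q L n"
    using Z_pos[of n L q p] assms by (simp add: field_simps)
  moreover have "pmf \<pi> \<eta> = 0" if "\<eta> \<notin> configs L n"
    using supp that by (auto simp: pmf_eq_0_set_pmf)
  ultimately show "pmf \<pi> \<eta> = pmf (product_pmf p q L n) \<eta>"
    using assms by (simp add: pmf_product_pmf C)
qed

text \<open>Without vacancies every weight is an empty product, so the uniform convention at
  \<open>L = n + 1\<close> gives the same formula.\<close>

lemma steady_state_eq_product_pmf:
  assumes "n + 1 \<le> L" "0 \<le> q" "q \<le> p" "0 < p"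
  shows "steady_state p q L n = product_pmf p q L n"
proof (cases "L = n + 1")
  case True
  have one: "ring_weight p q n \<eta> = 1" if \<eta>: "\<eta> \<in> configs L n" for \<eta>
  proof -
    have "count_list \<eta> Vacancy = 0"
      using \<eta> True length_eq_count_letters[of \<eta>] by (simp add: configs_def)
    moreover obtain u v where "\<eta> = u @ Tracer # v" "v @ u \<in> words (L - 1) n"
      using configs_split[OF \<eta>] .
    ultimately show ?thesis
      using environment_append[of u v]
      by (auto simp: ring_weight_def words_def count_list_0_iff intro!: word_weight_no_Vacancy)
  qed
  then have "Z p q L n = real (card (configs L n))"
    using sum_ring_weight[where p = p and q = q and L = L and n = n] by simp
  then have "pmf_of_set (configs L n) = product_pmf p q L n"
    using assms one configs_nonempty[of n L]
    by (intro pmf_eqI) (simp add: pmf_product_pmf)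
  then show ?thesis using True by (simp add: steady_state_def)
next
  case False
  then have "n + 2 \<le> L" using assms by simp
  then have "(THE \<pi>. stationary p q L n \<pi>) = product_pmf p q L n"
    using assms stationary_product_pmf stationary_unique by (intro the_equality) auto
  then show ?thesis using False by (simp add: steady_state_def)
qed

section \<open>The correlation between the tracer and a particle\<close>

theorem theorem4p3:
  fixes L n i :: nat and p q :: real
  assumes "n \<ge> 1" and "L \<ge> n + 1"
    and "0 \<le> q" and "q \<le> p" and "p \<le> 1" and "p > 0"
    and "2 \<le> i" and "i \<le> L"
  shows "measure_pmf.expectation (steady_state p q L n) (\<lambda>\<eta>. \<sigma> 1 \<eta> * \<tau> i \<eta>) =
    (\<Sum>j = 0..L - n - 1. \<Sum>k = 0..j.
       real ((L - i) choose k) * real ((i - 2) choose (j - k)) * p ^ k * q ^ (j - k)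
         * (brace p q (L - j - 1) n / Z p q L n))"
proof -
  \<comment> \<open>The numbers of sites between the tracer and site \<open>i\<close>, of sites
    after \<open>i\<close>, and of particles other than the one at \<open>i\<close>.\<close>
  define a b m where "a = i - 2" and "b = L - i" and "m = n - 1"
  have i: "i = a + 2" and L: "L = Suc (Suc (a + b))" and n: "n = Suc m" and m: "m \<le> a + b"
    using assms by (auto simp: a_def b_def m_def)
  have pmf: "pmf (steady_state p q L n) \<eta> =
    (if \<eta> \<in> configs L n then ring_weight p q n \<eta> / Z p q L n else 0)" for \<eta>
    using assms by (simp add: steady_state_eq_product_pmf pmf_product_pmf)
  have "measure_pmf.expectation (steady_state p q L n) (\<lambda>\<eta>. \<sigma> 1 \<eta> * \<tau> i \<eta>)
      = (\<Sum>\<eta>\<in>configs L n. \<sigma> 1 \<eta> * \<tau> i \<eta> * pmf (steady_state p q L n) \<eta>)"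
    by (rule integral_measure_pmf_real) (auto simp: set_pmf_eq pmf split: if_splits)
  also have "\<dots> = (\<Sum>\<eta>\<in>configs L n. \<sigma> 1 \<eta> * (\<tau> i \<eta> * ring_weight p q n \<eta>)) / Z p q L n"
    by (simp add: pmf sum_divide_distrib mult.assoc)
  also have "(\<Sum>\<eta>\<in>configs L n. \<sigma> 1 \<eta> * (\<tau> i \<eta> * ring_weight p q n \<eta>))
      = (\<Sum>\<eta> | \<eta> \<in> configs L n \<and> site \<eta> 1 = Tracer. \<tau> i \<eta> * ring_weight p q n \<eta>)"
    by (simp add: \<sigma>_def Int_def)
  \<comment> \<open>With the tracer at site 1, site \<open>i = a + 2\<close> is position
    \<open>a\<close> of the environment.\<close>
  also have "\<dots> = (\<Sum>v\<in>words (Suc (a + b)) n.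
       of_bool (v ! a = Particle) * word_weight (p - q) (1 + q * real n) v)"
    unfolding L configs_Tracer_first
    by (simp add: sum.reindex \<tau>_def site_def i ring_weight_def environment_Tracer_first del: sum_of_bool_mult_eq)
  also have "\<dots> = (\<Sum>j\<le>a + b - m. \<Sum>k\<le>j.
       real (b choose k) * real (a choose (j - k)) * p ^ k * q ^ (j - k)
         * brace p q (Suc (a + b - j)) n)"
    unfolding n by (rule sum_Particle_at[OF m])
  also have "\<dots> / Z p q L n = (\<Sum>j\<le>a + b - m. \<Sum>k\<le>j.
       real (b choose k) * real (a choose (j - k)) * p ^ k * q ^ (j - k)
         * (brace p q (Suc (a + b - j)) n / Z p q L n))"
    by (simp add: sum_divide_distrib)
  also have "\<dots> = (\<Sum>j = 0..L - n - 1. \<Sum>k = 0..j.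
       real ((L - i) choose k) * real ((i - 2) choose (j - k)) * p ^ k * q ^ (j - k)
         * (brace p q (L - j - 1) n / Z p q L n))"
    unfolding atLeast0AtMost using L n i by (intro sum.cong) (auto simp: Suc_diff_le)
  finally show ?thesis .
qed

end
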